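(* For all $n\ge1$, $$A_n=[(n-1)_T\,0]_T+1,\qquad B_n=[(n-1)_T\,01]_T+1,\qquad C_n=[(n-1)_T\,011]_T+1.$$
   Context: Tribonacci numbers: $T_{-3}=T_{-2}=0$, $T_{-1}=1$, $T_n=T_{n-1}+T_{n-2}+T_{n-3}$ for $n\ge0$ (so $T_0=1,T_1=2,T_2=4,T_3=7$). For a finite binary string $E=e_1\cdots e_i$, $[E]_T=\sum_{1\le j\le i}e_jT_{i-j}$. For an integer $m\ge0$, $(m)_T$ is the canonical Tribonacci representation of $m$: the binary string obtained by the greedy algorithm (repeatedly subtracting the largest possible Tribonacci number), least significant digit on the right, equivalently the string $E$ with $[E]_T=m$ having no three consecutive $1$'s (unique up to leading zeros). Expressions such as $(m)_T\,01$ denote concatenation of binary strings. The Tribonacci word $\mathbf T=t_1t_2t_3\cdots$ (indexed from $1$) is the infinite fixed point, beginning with $a$, of the morphism $\tau: a\to ab,\ b\to ac,\ c\to a$. For $n\ge1$, $A_n$ (resp. $B_n$, $C_n$) is the index of the $n$th occurrence of the letter $a$ (resp. $b$, $c$) in $\mathbf T$. *)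

theory Defs
  imports "HOL-Library.Infinite_Set" "HOL-Library.Stream"
begin

(* Running the recurrence backwards from these values gives T_{-1} = 1 and T_{-2} = T_{-3} = 0. *)
fun trib :: "nat \<Rightarrow> nat" where
  "trib 0 = 1"
| "trib (Suc 0) = 2"
| "trib (Suc (Suc 0)) = 4"
| "trib (Suc (Suc (Suc n))) = trib (Suc (Suc n)) + trib (Suc n) + trib n"

(* Digit strings are lists with the most significant digit first. *)
definition trib_value :: "nat list \<Rightarrow> nat" where
  "trib_value E = (\<Sum>j=1..length E. E ! (j - 1) * trib (length E - j))"

fun trib_greedy :: "nat \<Rightarrow> nat \<Rightarrow> nat list" where
  "trib_greedy 0 m = []"
| "trib_greedy (Suc k) m =
     (if trib k \<le> m then 1 # trib_greedy k (m - trib k) else 0 # trib_greedy k m)"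

(* Since trib (k + 1) <= 2 * trib k, the greedy algorithm never subtracts the same number twice,
   so it can be run as one downward scan. Starting just below the first Tribonacci number exceeding m avoids leading zeros;
   in particular 0 is represented by the empty string. *)
definition trib_rep :: "nat \<Rightarrow> nat list" where
  "trib_rep m = trib_greedy (LEAST k. m < trib k) m"

lemma trib_Suc_le: "trib (Suc n) \<le> 2 * trib n" and trib_pos: "trib n > 0" and trib_less_Suc: "trib n < trib (Suc n)"
proof -
  have "trib n > 0 \<and> trib n < trib (Suc n) \<and> trib (Suc n) \<le> 2 * trib n" for n
    by (induction n rule: trib.induct) auto
  then show "trib (Suc n) \<le> 2 * trib n" "trib n > 0" "trib n < trib (Suc n)" by auto
qed

lemma trib_value_Cons: "trib_value (d # E) = d * trib (length E) + trib_value E"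
proof -
  have "trib_value (d # E) = (\<Sum>j=Suc 0..Suc (length E). (d # E) ! (j - 1) * trib (Suc (length E) - j))"
    by (simp add: trib_value_def)
  also have "\<dots> = d * trib (length E) + (\<Sum>j=Suc 1..Suc (length E). (d # E) ! (j - 1) * trib (Suc (length E) - j))"
    by (subst sum.atLeast_Suc_atMost) auto
  also have "(\<Sum>j=Suc 1..Suc (length E). (d # E) ! (j - 1) * trib (Suc (length E) - j)) = trib_value E"
    unfolding trib_value_def by (subst sum.shift_bounds_cl_Suc_ivl) (auto intro!: sum.cong simp: nth_Cons split: nat.split)
  finally show ?thesis .
qed

lemma trib_greedy_correct: "m < trib k \<Longrightarrow> length (trib_greedy k m) = k \<and> trib_value (trib_greedy k m) = m \<and> set (trib_greedy k m) \<subseteq> {0,1}"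
proof (induction k arbitrary: m)
  case 0 then show ?case by (simp add: trib_value_def)
next
  case (Suc k) then show ?case using trib_Suc_le[of k] Suc.IH[of "m - trib k"] Suc.IH[of m] by (auto simp: trib_value_Cons)
qed

lemma trib_value_rep: "trib_value (trib_rep m) = m" and set_trib_rep: "set (trib_rep m) \<subseteq> {0,1}"
proof -
  have "k < trib k" for k by (induction k) (use trib_less_Suc in \<open>auto intro: le_less_trans Suc_leI\<close>)
  then have "m < trib (LEAST k. m < trib k)" by (rule LeastI)
  then show "trib_value (trib_rep m) = m" "set (trib_rep m) \<subseteq> {0,1}" using trib_greedy_correct by (auto simp: trib_rep_def)
qed

datatype letter = La | Lb | Lc

fun tau :: "letter \<Rightarrow> letter list" where
  "tau La = [La, Lb]"
| "tau Lb = [La, Lc]"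
| "tau Lc = [La]"

definition tau_iter :: "nat \<Rightarrow> letter list" where "tau_iter n = ((\<lambda>v. concat (map tau v)) ^^ n) [La]"

lemma tau_iter_0: "tau_iter 0 = [La]" and tau_iter_Suc: "tau_iter (Suc n) = concat (map tau (tau_iter n))"
  by (simp_all add: tau_iter_def)

lemma tau_ne: "tau x \<noteq> []" by (cases x) auto

lemma flat_smap_tau:
  "flat (smap tau w) = concat (map tau (stake k w)) @- flat (smap tau (sdrop k w))"
proof (induction k arbitrary: w)
  case (Suc k)
  have "flat (smap tau w) = tau (shd w) @- flat (smap tau (stl w))"
    by (subst flat_unfold) (simp_all add: tau_ne)
  then show ?case using Suc[of "stl w"] by simp
qed simp

lemma tau_iter_ext: "\<exists>v. v \<noteq> [] \<and> tau_iter (Suc n) = tau_iter n @ v"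
proof (induction n)
  case 0 then show ?case by (simp add: tau_iter_0 tau_iter_Suc)
next
  case (Suc n)
  then obtain v where v: "v \<noteq> []" "tau_iter (Suc n) = tau_iter n @ v" by blast
  have "tau_iter (Suc (Suc n)) = tau_iter (Suc n) @ concat (map tau v)"
    by (subst tau_iter_Suc, subst v(2)) (simp add: tau_iter_Suc)
  moreover have "concat (map tau v) \<noteq> []" using v(1) tau_ne by (cases v) auto
  ultimately show ?case by blast
qed

lemma length_tau_iter: "n < length (tau_iter n)"
proof (induction n)
  case (Suc n) then show ?case using tau_iter_ext[of n] by (metis Suc_lessI length_append length_greater_0_conv less_add_same_cancel1 not_less_eq order_less_trans)
qed (simp add: tau_iter_0)

lemma tau_iter_nth: "m \<le> n \<Longrightarrow> i < length (tau_iter m) \<Longrightarrow> i < length (tau_iter n) \<and> tau_iter n ! i = tau_iter m ! i"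
proof (induction n rule: dec_induct)
  case (step n)
  obtain v where "tau_iter (Suc n) = tau_iter n @ v" using tau_iter_ext by blast
  with step show ?case by (auto simp: nth_append)
qed simp

lemma stream_snth_eqI: "(\<And>i. s !! i = t !! i) \<Longrightarrow> s = t"
  by (metis ext stream_smap_nats)

lemma stake_eqI:
  assumes "\<And>i. i < length v \<Longrightarrow> w !! i = v ! i" shows "stake (length v) w = v"
  by (rule nth_equalityI) (auto simp: assms)

lemma trib_word_ex1: "\<exists>!w. shd w = La \<and> flat (smap tau w) = w"
proof (rule ex1I[of _ "smap (\<lambda>n. tau_iter n ! n) nats"])
  let ?w = "smap (\<lambda>n. tau_iter n ! n) nats"
  define w where "w = ?w"
  have w: "w !! i = tau_iter n ! i" if "i < length (tau_iter n)" for i n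
  proof -
    have "w !! i = tau_iter i ! i" by (simp add: w_def)
    then show ?thesis using tau_iter_nth[of i n i] tau_iter_nth[of n i i] that length_tau_iter[of i]
      by (cases "i \<le> n") auto
  qed
  have st: "stake (length (tau_iter n)) w = tau_iter n" for n by (rule stake_eqI) (rule w)
  have "flat (smap tau w) !! i = w !! i" for i
  proof -
    have "flat (smap tau w) = tau_iter (Suc i) @- flat (smap tau (sdrop (length (tau_iter i)) w))"
      by (subst flat_smap_tau[of w "length (tau_iter i)"]) (simp add: st tau_iter_Suc)
    then show ?thesis using length_tau_iter[of "Suc i"] w[of i "Suc i"] by simp
  qed
  then have "flat (smap tau w) = w" by (rule stream_snth_eqI)
  moreover have "shd w = La" using w[of 0 0] by (simp add: tau_iter_0)
  ultimately show "shd ?w = La \<and> flat (smap tau ?w) = ?w" by (simp add: w_def)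
next
  fix w assume w: "shd w = La \<and> flat (smap tau w) = w"
  have st: "stake (length (tau_iter n)) w = tau_iter n" for n
  proof (induction n)
    case (Suc n)
    have "w = tau_iter (Suc n) @- flat (smap tau (sdrop (length (tau_iter n)) w))"
      using flat_smap_tau[of w "length (tau_iter n)"] Suc w by (simp add: tau_iter_Suc)
    then have "stake (length (tau_iter (Suc n))) w = stake (length (tau_iter (Suc n))) \<dots>" by simp
    then show ?case by (simp add: stake_shift)
  qed (use w in \<open>simp add: tau_iter_0\<close>)
  show "w = smap (\<lambda>n. tau_iter n ! n) nats"
  proof (rule stream_snth_eqI)
    fix i
    have "w !! i = stake (length (tau_iter i)) w ! i" using length_tau_iter[of i] by simp
    then show "w !! i = smap (\<lambda>n. tau_iter n ! n) nats !! i" using st[of i] by simp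
  qed
qed

(* The image of an infinite word w under the morphism tau is flat (smap tau w); by
   trib_word_ex1 the fixed point starting with La exists and is unique. *)
definition trib_word :: "letter stream" where
  "trib_word = (THE w. shd w = La \<and> flat (smap tau w) = w)"

(* Streams are indexed from 0, whereas positions in the word are counted from 1. *)
definition occurrence :: "letter \<Rightarrow> nat \<Rightarrow> nat" where
  "occurrence x n = enumerate {i. i \<ge> 1 \<and> trib_word !! (i - 1) = x} (n - 1)"

end

theory Submission
  imports Defs
begin

text \<open>
  Write \<open>w\<close> for the Tribonacci word, indexed from 0, and let \<open>L m\<close> (\<open>block_start\<close>) be the length of the
  \<open>\<tau>\<close>-image of its prefix of length \<open>m\<close>. Since \<open>w = \<tau>(w)\<close>, the word is a concatenation of blocks
  \<open>\<tau>(w\<^sub>m)\<close>, the \<open>m\<close>-th of which starts at position \<open>L m\<close>. Each block starts with its only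
  letter \<open>a\<close>; a \<open>b\<close> occurs exactly as the second letter of the image of an \<open>a\<close>, and a
  \<open>c\<close> exactly as the second letter of the image of a \<open>b\<close>. Hence the \<open>m\<close>-th occurrences
  (counting from 0) of the three letters are at \<open>L m\<close>, at \<open>L (L m) + 1\<close> and at
  \<open>L (L (L m) + 1) + 1 = L (L (L m)) + 3\<close> (\<open>positions_La\<close>, \<open>positions_Lb\<close>, \<open>positions_Lc\<close>).

  It remains to see that \<open>L\<close>, iterated \<open>j\<close> times, appends \<open>j\<close> zeros to the Tribonacci
  representation (\<open>block_start_iter_rep\<close>); then the constants 1 and 3 are the values of the
  digit strings \<open>01\<close> and \<open>011\<close>. The word \<open>\<tau>\<^sup>k(a)\<close> has length \<open>T\<^sub>k\<close>, and within the prefix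
  \<open>\<tau>\<^sup>k\<^sup>+\<^sup>1(a)\<close> of \<open>w\<close> what follows \<open>\<tau>\<^sup>k(a)\<close> is again a prefix of \<open>w\<close>, except possibly for its
  last letter. So if \<open>T\<^sub>k \<le> m < T\<^sub>k\<^sub>+\<^sub>1\<close>, the prefix of length \<open>m\<close> is
  \<open>\<tau>\<^sup>k(a)\<close> followed by the prefix of length \<open>m - T\<^sub>k\<close> (\<open>stake_trib_add\<close>), which is one step of the
  greedy algorithm. Applying \<open>\<tau>\<^sup>j\<close> replaces \<open>T\<^sub>k\<close> by \<open>T\<^sub>k\<^sub>+\<^sub>j\<close> in each step.
\<close>

section \<open>Enumerations and digit strings\<close>

lemma enumerate_range_strict_mono:
  fixes g :: "nat \<Rightarrow> nat"
  assumes "strict_mono g"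
  shows "enumerate (range g) n = g n"
proof (induction n)
  case 0
  have "(LEAST x. x \<in> range g) = g 0"
    by (rule Least_equality) (use assms in \<open>auto simp: strict_mono_less_eq\<close>)
  then show ?case by (simp add: enumerate_0)
next
  case (Suc n)
  have "infinite (range g)"
    using assms by (simp add: range_inj_infinite strict_mono_imp_inj_on)
  then have "enumerate (range g) (Suc n) = (LEAST s. s \<in> range g \<and> enumerate (range g) n < s)"
    by (rule enumerate_Suc'')
  also have "\<dots> = g (Suc n)"
    by (rule Least_equality) (use assms Suc.IH in \<open>auto simp: strict_mono_less strict_mono_less_eq\<close>)
  finally show ?case .
qed

lemma trib_value_Nil: "trib_value [] = 0"
  by (simp add: trib_value_def)

lemma trib_value_zeros: "trib_value (replicate j 0) = 0"
  by (induction j) (simp_all add: trib_value_Nil trib_value_Cons)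

lemma trib_value_append:
  "trib_value (E @ F) = trib_value (E @ replicate (length F) 0) + trib_value F"
  by (induction E) (simp_all add: trib_value_zeros trib_value_Cons)

section \<open>The words generated by the morphism\<close>

text \<open>The image of a finite word under the morphism \<open>\<tau>\<close>.\<close>
definition tau_image :: "letter list \<Rightarrow> letter list" where
  "tau_image v = concat (map tau v)"

lemma tau_image_simps [simp]:
  "tau_image [] = []"
  "tau_image (x # v) = tau x @ tau_image v"
  "tau_image (u @ v) = tau_image u @ tau_image v"
  by (simp_all add: tau_image_def)

lemma tau_image_iter_append:
  "(tau_image ^^ j) (u @ v) = (tau_image ^^ j) u @ (tau_image ^^ j) v"
  by (induction j) simp_all

lemma tau_iter_Suc_image: "tau_iter (Suc n) = tau_image (tau_iter n)"
  by (simp add: tau_iter_Suc tau_image_def)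

lemma tau_image_iter_tau_iter: "(tau_image ^^ j) (tau_iter k) = tau_iter (k + j)"
  by (induction j) (simp_all add: tau_iter_Suc_image)

lemma tau_iter_rec: "tau_iter (n + 3) = tau_iter (n + 2) @ tau_iter (n + 1) @ tau_iter n"
  by (induction n) (simp_all add: tau_iter_Suc_image tau_iter_0 numeral_eq_Suc)

lemma length_tau_iter_eq_trib: "length (tau_iter n) = trib n"
proof (induction n rule: trib.induct)
  case (4 n)
  then show ?case using tau_iter_rec[of n] by (simp add: numeral_eq_Suc)
qed (simp_all add: tau_iter_Suc_image tau_iter_0)

text \<open>
  What follows \<open>\<tau>\<^sup>k(a)\<close> in \<open>\<tau>\<^sup>k\<^sup>+\<^sup>1(a)\<close> is a prefix of \<open>\<tau>\<^sup>k(a)\<close> up to at most one final letter \<open>p\<close>.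
  From \<open>k = 3\<close> on it is \<open>\<tau>\<^sup>k\<^sup>-\<^sup>1(a) \<tau>\<^sup>k\<^sup>-\<^sup>2(a)\<close>, with which \<open>\<tau>\<^sup>k(a)\<close> begins by the same recurrence.
\<close>
lemma tau_iter_Suc_split:
  "\<exists>y p q. tau_iter (Suc k) = tau_iter k @ y @ p \<and> tau_iter k = y @ q \<and> length p \<le> 1"
proof -
  consider "k = 0" | "k = 1" | "k = 2" | n where "k = n + 3"
    by (metis add.commute le_add_diff_inverse2 less_Suc0 less_Suc_eq not_less numeral_2_eq_2
        numeral_3_eq_3 One_nat_def)
  then show ?thesis
  proof cases
    case 1
    then have "tau_iter (Suc k) = tau_iter k @ [] @ [Lb]" "tau_iter k = [] @ [La]"
      by (simp_all add: tau_iter_Suc_image tau_iter_0)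
    moreover have "length ([Lb] :: letter list) \<le> 1" by simp
    ultimately show ?thesis by blast
  next
    case 2
    then have "tau_iter (Suc k) = tau_iter k @ [La] @ [Lc]" "tau_iter k = [La] @ [Lb]"
      by (simp_all add: tau_iter_Suc_image tau_iter_0)
    moreover have "length ([Lc] :: letter list) \<le> 1" by simp
    ultimately show ?thesis by blast
  next
    case 3
    then have "tau_iter (Suc k) = tau_iter k @ [La, Lb, La] @ []"
      "tau_iter k = [La, Lb, La] @ [Lc]"
      by (simp_all add: tau_iter_Suc_image tau_iter_0 numeral_eq_Suc)
    moreover have "length ([] :: letter list) \<le> 1" by simp
    ultimately show ?thesis by blast
  next
    case 4
    then have "tau_iter (Suc k) = tau_iter k @ (tau_iter (n + 2) @ tau_iter (n + 1)) @ []"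
      "tau_iter k = (tau_iter (n + 2) @ tau_iter (n + 1)) @ tau_iter n"
      using tau_iter_rec[of n] tau_iter_rec[of "n + 1"] by (simp_all add: numeral_eq_Suc)
    moreover have "length ([] :: letter list) \<le> 1" by simp
    ultimately show ?thesis by blast
  qed
qed

section \<open>Positions of the letters\<close>

lemma shd_trib_word: "shd trib_word = La"
  and flat_trib_word: "flat (smap tau trib_word) = trib_word"
  using theI'[OF trib_word_ex1] by (simp_all add: trib_word_def)

lemma trib_word_image:
  "trib_word = tau_image (stake k trib_word) @- flat (smap tau (sdrop k trib_word))"
  using flat_smap_tau[of trib_word k] by (simp add: flat_trib_word tau_image_def)

text \<open>The position at which the image of the letter number \<open>m\<close> starts in \<open>w = \<tau>(w)\<close>.\<close>
definition block_start :: "nat \<Rightarrow> nat" where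
  "block_start m = length (tau_image (stake m trib_word))"

lemma stake_block_start: "stake (block_start m) trib_word = tau_image (stake m trib_word)"
  using arg_cong[OF trib_word_image[of m], of "stake (block_start m)"]
  by (simp add: block_start_def stake_shift)

lemma sdrop_block_start: "sdrop (block_start m) trib_word = flat (smap tau (sdrop m trib_word))"
  using arg_cong[OF trib_word_image[of m], of "sdrop (block_start m)"]
  by (simp add: block_start_def sdrop_shift)

lemma block_start_0: "block_start 0 = 0"
  by (simp add: block_start_def)

lemma block_start_Suc: "block_start (Suc m) = block_start m + length (tau (trib_word !! m))"
  unfolding block_start_def by (subst stake_Suc) simp

lemma strict_mono_block_start: "strict_mono block_start"
  using tau_ne by (simp add: strict_mono_Suc_iff block_start_Suc)

lemma snth_block_start:
  assumes "r < length (tau (trib_word !! m))"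
  shows "trib_word !! (block_start m + r) = tau (trib_word !! m) ! r"
proof -
  have "trib_word !! (block_start m + r) = sdrop (block_start m) trib_word !! r"
    by (simp add: sdrop_snth add.commute)
  also have "\<dots> = (tau (trib_word !! m) @- flat (smap tau (sdrop (Suc m) trib_word))) !! r"
    unfolding sdrop_block_start by (subst flat_unfold) (simp_all add: tau_ne)
  finally show ?thesis using assms by simp
qed

lemma block_decomposition:
  obtains m r where "i = block_start m + r" "r < length (tau (trib_word !! m))"
proof -
  have "\<exists>m r. i = block_start m + r \<and> r < length (tau (trib_word !! m))"
  proof (induction i)
    case 0
    then show ?case using tau_ne by (intro exI[of _ 0]) (simp add: block_start_0)
  next
    case (Suc i)
    then obtain m r where mr: "i = block_start m + r" "r < length (tau (trib_word !! m))"
      by blast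
    show ?case
    proof (cases "Suc r < length (tau (trib_word !! m))")
      case True
      with mr show ?thesis by (intro exI[of _ m] exI[of _ "Suc r"]) simp
    next
      case False
      with mr have "Suc i = block_start (Suc m)" by (simp add: block_start_Suc)
      then show ?thesis using tau_ne by (intro exI[of _ "Suc m"] exI[of _ 0]) simp
    qed
  qed
  with that show ?thesis by blast
qed

lemma snth_eq_La_iff: "trib_word !! i = La \<longleftrightarrow> (\<exists>m. i = block_start m)"
proof
  assume *: "trib_word !! i = La"
  obtain m r where mr: "i = block_start m + r" "r < length (tau (trib_word !! m))"
    by (rule block_decomposition)
  with * have "tau (trib_word !! m) ! r = La" using snth_block_start by simp
  with mr(2) have "r = 0" by (cases "trib_word !! m") (auto simp: less_Suc_eq)
  with mr show "\<exists>m. i = block_start m" by auto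
next
  assume "\<exists>m. i = block_start m"
  then obtain m where "i = block_start m + 0" by auto
  then show "trib_word !! i = La"
    using snth_block_start[of 0 m] by (cases "trib_word !! m") auto
qed

text \<open>Applied to \<open>x = a, y = b\<close> and to \<open>x = b, y = c\<close>.\<close>
lemma snth_eq_second_iff:
  assumes "tau x = [La, y]" "y \<noteq> La"
  shows "trib_word !! i = y \<longleftrightarrow> (\<exists>m. i = block_start m + 1 \<and> trib_word !! m = x)"
proof
  assume *: "trib_word !! i = y"
  obtain m r where mr: "i = block_start m + r" "r < length (tau (trib_word !! m))"
    by (rule block_decomposition)
  with * have "tau (trib_word !! m) ! r = y" using snth_block_start by simp
  with mr(2) assms have "r = 1 \<and> trib_word !! m = x"
    by (cases "trib_word !! m"; cases x) (auto simp: less_Suc_eq)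
  with mr show "\<exists>m. i = block_start m + 1 \<and> trib_word !! m = x" by auto
next
  assume "\<exists>m. i = block_start m + 1 \<and> trib_word !! m = x"
  then obtain m where "i = block_start m + 1" "trib_word !! m = x" by blast
  then show "trib_word !! i = y" using snth_block_start[of 1 m] assms by simp
qed

lemma positions_La: "{i. trib_word !! i = La} = range block_start"
  by (auto simp: snth_eq_La_iff)

lemma positions_Lb: "{i. trib_word !! i = Lb} = range (\<lambda>m. block_start (block_start m) + 1)"
  by (auto simp: snth_eq_second_iff[of La] snth_eq_La_iff)

lemma positions_Lc:
  "{i. trib_word !! i = Lc} = range (\<lambda>m. block_start (block_start (block_start m)) + 3)"
proof -
  have "block_start (block_start (block_start m) + 1) = block_start (block_start (block_start m)) + 2"
    for m
  proof -
    have "trib_word !! block_start (block_start m) = La" by (auto simp: snth_eq_La_iff)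
    then show ?thesis by (simp add: block_start_Suc)
  qed
  moreover have "{i. trib_word !! i = Lc}
      = range (\<lambda>m. block_start (block_start (block_start m) + 1) + 1)"
    by (auto simp: snth_eq_second_iff[of Lb] snth_eq_second_iff[of La] snth_eq_La_iff)
  ultimately show ?thesis by (simp add: numeral_eq_Suc)
qed

lemma occurrence_eq:
  assumes "{i. trib_word !! i = x} = range g" "strict_mono g"
  shows "occurrence x n = g (n - 1) + 1"
proof -
  have "{i. i \<ge> 1 \<and> trib_word !! (i - 1) = x} = Suc ` {i. trib_word !! i = x}"
    by (auto simp: image_iff intro!: exI[of _ "_ - 1"])
  also have "\<dots> = range (\<lambda>m. Suc (g m))"
    unfolding assms(1) by auto
  finally show ?thesis
    using enumerate_range_strict_mono[of "\<lambda>m. Suc (g m)" "n - 1"] assms(2)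
    by (simp add: occurrence_def strict_mono_Suc_iff)
qed

section \<open>Prefixes of the Tribonacci word and the greedy algorithm\<close>

lemma stake_trib: "stake (trib k) trib_word = tau_iter k"
proof (induction k)
  case 0
  then show ?case by (simp add: tau_iter_0 shd_trib_word)
next
  case (Suc k)
  then have "block_start (trib k) = trib (Suc k)"
    unfolding block_start_def by (simp flip: tau_iter_Suc_image add: length_tau_iter_eq_trib)
  then show ?case using Suc.IH stake_block_start[of "trib k"] by (simp add: tau_iter_Suc_image)
qed

lemma stake_trib_add:
  assumes "trib k + r < trib (Suc k)"
  shows "stake (trib k + r) trib_word = tau_iter k @ stake r trib_word"
proof -
  obtain y p q where *: "tau_iter (Suc k) = tau_iter k @ y @ p" "tau_iter k = y @ q" "length p \<le> 1"
    using tau_iter_Suc_split by blast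
  have "trib (Suc k) = trib k + length y + length p" "trib k = length y + length q"
    using arg_cong[OF *(1), of length] arg_cong[OF *(2), of length]
    by (simp_all add: length_tau_iter_eq_trib)
  \<comment> \<open>The bound in the assumption is strict, so the exceptional letter \<open>p\<close> is never reached.\<close>
  with assms *(3) have r: "r \<le> length y" "r \<le> trib k" by linarith+
  have "stake (trib k + r) trib_word = take (trib k + r) (stake (trib (Suc k)) trib_word)"
    using assms by (simp add: take_stake min_def)
  also have "\<dots> = tau_iter k @ take r y"
    using r by (simp add: stake_trib *(1) length_tau_iter_eq_trib)
  also have "take r y = take r (stake (trib k) trib_word)"
    using r by (simp add: stake_trib *(2))
  also have "\<dots> = stake r trib_word"
    using r by (simp add: take_stake min_def)
  finally show ?thesis .
qed

lemma block_start_iter_eq_length: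
  "(block_start ^^ j) m = length ((tau_image ^^ j) (stake m trib_word))"
proof -
  have "stake ((block_start ^^ j) m) trib_word = (tau_image ^^ j) (stake m trib_word)"
    by (induction j) (simp_all add: stake_block_start)
  then show ?thesis by (metis length_stake)
qed

text \<open>
  Leading zeros are harmless here, so the scan may start at any \<open>k\<close> with \<open>m < T\<^sub>k\<close>; this makes
  the induction on \<open>k\<close> possible.
\<close>
lemma block_start_iter_greedy:
  "m < trib k \<Longrightarrow> (block_start ^^ j) m = trib_value (trib_greedy k m @ replicate j 0)"
proof (induction k arbitrary: m)
  case 0
  have "(block_start ^^ j) 0 = 0" by (induction j) (simp_all add: block_start_0)
  then show ?case using 0 by (simp add: trib_value_zeros)
next
  case (Suc k)
  show ?case
  proof (cases "trib k \<le> m")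
    case False
    then show ?thesis using Suc.IH[of m] by (simp add: trib_value_Cons)
  next
    case True
    define r where "r = m - trib k"
    have m: "m = trib k + r" using True by (simp add: r_def)
    have r: "r < trib k" using Suc.prems trib_Suc_le[of k] m by linarith
    have "(block_start ^^ j) m = trib (k + j) + (block_start ^^ j) r"
      using stake_trib_add[of k r] Suc.prems m
      by (simp add: block_start_iter_eq_length tau_image_iter_append tau_image_iter_tau_iter
          length_tau_iter_eq_trib)
    also have "\<dots> = trib_value (trib_greedy (Suc k) m @ replicate j 0)"
      using Suc.IH[OF r] trib_greedy_correct[OF r] True
      by (simp add: trib_value_Cons flip: r_def)
    finally show ?thesis .
  qed
qed

lemma block_start_iter_rep: "(block_start ^^ j) m = trib_value (trib_rep m @ replicate j 0)"
proof -
  have "k < trib k" for k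
    by (induction k) (use trib_less_Suc in \<open>auto intro: le_less_trans Suc_leI\<close>)
  then have "m < trib (LEAST k. m < trib k)" by (rule LeastI)
  then show ?thesis unfolding trib_rep_def by (rule block_start_iter_greedy)
qed

theorem theorem14:
  fixes n :: nat
  assumes "n \<ge> 1"
  shows "occurrence La n = trib_value (trib_rep (n - 1) @ [0]) + 1
    \<and> occurrence Lb n = trib_value (trib_rep (n - 1) @ [0, 1]) + 1
    \<and> occurrence Lc n = trib_value (trib_rep (n - 1) @ [0, 1, 1]) + 1"
proof -
  define m where "m = n - 1"
  have mono: "block_start i < block_start j \<longleftrightarrow> i < j" for i j
    using strict_mono_block_start by (rule strict_mono_less)
  have "occurrence La n = block_start m + 1"
    unfolding m_def by (rule occurrence_eq[OF positions_La strict_mono_block_start])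
  moreover have "occurrence Lb n = block_start (block_start m) + 1 + 1"
    unfolding m_def by (rule occurrence_eq[OF positions_Lb]) (simp add: strict_mono_def mono)
  moreover have "occurrence Lc n = block_start (block_start (block_start m)) + 3 + 1"
    unfolding m_def by (rule occurrence_eq[OF positions_Lc]) (simp add: strict_mono_def mono)
  moreover have "block_start m = trib_value (trib_rep m @ [0])"
    using block_start_iter_rep[of 1 m] by simp
  moreover have "block_start (block_start m) + 1 = trib_value (trib_rep m @ [0, 1])"
    using block_start_iter_rep[of 2 m] trib_value_append[of "trib_rep m" "[0, 1]"]
    by (simp add: numeral_eq_Suc trib_value_Cons trib_value_Nil)
  moreover have "block_start (block_start (block_start m)) + 3 = trib_value (trib_rep m @ [0, 1, 1])"
    using block_start_iter_rep[of 3 m] trib_value_append[of "trib_rep m" "[0, 1, 1]"]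
    by (simp add: numeral_eq_Suc trib_value_Cons trib_value_Nil)
  ultimately show ?thesis unfolding m_def by presburger
qed

end
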